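(* If $G=(V,E)$ is a tree and $|V|\ge 3$, then $\widetilde{\chi}(G)=2$.
   Context: Graphs are finite and without loops. For $x\in V$, $E(x)$ denotes the set of edges of $G$ incident to $x$. For an integer $m\ge 2$, an $m$-homogeneous edge-coloring of $G$ is a map $c\colon E\to S$, where $S$ is a set of colors with $|S|=m$ ($c$ is not required to be surjective or proper), such that for every $x\in V$, writing $|E(x)|=m q_x+r_x$ with $0\le r_x<m$, exactly $r_x$ of the colors in $S$ are each assigned to exactly $q_x+1$ edges of $E(x)$, and each of the other $m-r_x$ colors is assigned to exactly $q_x$ edges of $E(x)$. (In particular, if $|E(x)|<m$, the edges of $E(x)$ have pairwise different colors.) The homogeneous chromatic index $\widetilde{\chi}(G)$ is the minimum integer $m\ge 2$ such that $G$ admits an $m$-homogeneous edge-coloring. *)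

theory Defs
  imports Main "HOL-Library.FuncSet"
begin

text \<open>
  Finite loopless graphs on a vertex set \<open>V\<close> with edge set \<open>E\<close>, where \<open>ends e\<close> is the set of the
  two end vertices of \<open>e\<close>. Parallel edges are allowed; simple graphs are the case where \<open>ends\<close> is
  injective on \<open>E\<close>.
\<close>

locale graph =
  fixes V :: "'v set" and E :: "'e set" and ends :: "'e \<Rightarrow> 'v set"
  assumes finite_V: "finite V"
    and finite_E: "finite E"
    and ends_subset: "e \<in> E \<Longrightarrow> ends e \<subseteq> V"
    and card_ends: "e \<in> E \<Longrightarrow> card (ends e) = 2"

definition incident_edges :: "'e set \<Rightarrow> ('e \<Rightarrow> 'v set) \<Rightarrow> 'v \<Rightarrow> 'e set" where
  "incident_edges E ends x = {e \<in> E. x \<in> ends e}"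

definition adjacency :: "'e set \<Rightarrow> ('e \<Rightarrow> 'v set) \<Rightarrow> ('v \<times> 'v) set" where
  "adjacency E ends = {(u, v). \<exists>e\<in>E. ends e = {u, v}}"

definition connected_graph :: "'v set \<Rightarrow> 'e set \<Rightarrow> ('e \<Rightarrow> 'v set) \<Rightarrow> bool" where
  "connected_graph V E ends \<longleftrightarrow>
     V \<noteq> {} \<and> (\<forall>u\<in>V. \<forall>v\<in>V. (u, v) \<in> (adjacency E ends)\<^sup>*)"

text \<open>
  \<open>es ! i\<close> joins \<open>vs ! i\<close> to the cyclically next vertex. Requiring the edges to be distinct only
  matters for length 2, where it says that a cycle consists of two different parallel edges.
\<close>

definition is_cycle :: "'e set \<Rightarrow> ('e \<Rightarrow> 'v set) \<Rightarrow> 'v list \<Rightarrow> 'e list \<Rightarrow> bool" where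
  "is_cycle E ends vs es \<longleftrightarrow>
     es \<noteq> [] \<and> length vs = length es \<and> distinct vs \<and> distinct es \<and> set es \<subseteq> E \<and>
     (\<forall>i<length es. ends (es ! i) = {vs ! i, vs ! (Suc i mod length es)})"

locale tree = graph V E ends
  for V :: "'v set" and E :: "'e set" and ends :: "'e \<Rightarrow> 'v set" +
  assumes connected: "connected_graph V E ends"
    and acyclic: "\<nexists>vs es. is_cycle E ends vs es"

text \<open>Here \<open>R\<close> is the set of the \<open>r\<^sub>x\<close> colors that occur \<open>q\<^sub>x + 1\<close> times at \<open>x\<close>.\<close>

definition homogeneous_coloring ::
  "'v set \<Rightarrow> 'e set \<Rightarrow> ('e \<Rightarrow> 'v set) \<Rightarrow> nat \<Rightarrow> 'c set \<Rightarrow> ('e \<Rightarrow> 'c) \<Rightarrow> bool" where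
  "homogeneous_coloring V E ends m S c \<longleftrightarrow>
     finite S \<and> card S = m \<and> c \<in> E \<rightarrow> S \<and>
     (\<forall>x\<in>V.
        let q = card (incident_edges E ends x) div m;
            r = card (incident_edges E ends x) mod m;
            occ = (\<lambda>s. card {e \<in> incident_edges E ends x. c e = s})
        in \<exists>R\<subseteq>S. card R = r \<and> (\<forall>s\<in>R. occ s = q + 1) \<and> (\<forall>s\<in>S - R. occ s = q))"

definition homogeneously_colorable :: "'v set \<Rightarrow> 'e set \<Rightarrow> ('e \<Rightarrow> 'v set) \<Rightarrow> nat \<Rightarrow> bool" where
  "homogeneously_colorable V E ends m \<longleftrightarrow>
     (\<exists>(S :: nat set) c. homogeneous_coloring V E ends m S c)"

definition homogeneous_chromatic_index :: "'v set \<Rightarrow> 'e set \<Rightarrow> ('e \<Rightarrow> 'v set) \<Rightarrow> nat" where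
  "homogeneous_chromatic_index V E ends =
     (LEAST m. 2 \<le> m \<and> homogeneously_colorable V E ends m)"

text \<open>
  The minimum is always attained: with more colors than edges, any injective coloring is
  homogeneous.
\<close>

lemma (in graph) homogeneously_colorable_exists:
  "\<exists>m\<ge>2. homogeneously_colorable V E ends m"
proof -
  define m where "m = card E + 2"
  obtain c :: "'e \<Rightarrow> nat" where c: "bij_betw c E {0..<card E}"
    using ex_bij_betw_finite_nat[OF finite_E] by blast
  have "homogeneous_coloring V E ends m {0..<m} c"
    unfolding homogeneous_coloring_def Let_def
  proof (intro conjI ballI)
    show "c \<in> E \<rightarrow> {0..<m}"
      using bij_betwE[OF c] by (fastforce simp: m_def)
  next
    fix x
    let ?I = "incident_edges E ends x"
    have sub: "?I \<subseteq> E" by (auto simp: incident_edges_def)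
    have inj: "inj_on c ?I" using c sub by (meson bij_betw_def inj_on_subset)
    have lt: "card ?I < m" using card_mono[OF finite_E sub] by (simp add: m_def)
    have once: "card {e \<in> ?I. c e = s} = 1" if s: "s \<in> c ` ?I" for s
    proof -
      obtain e where e: "e \<in> ?I" "s = c e" using s by blast
      then have "{e' \<in> ?I. c e' = s} = {e}" using inj by (auto dest: inj_onD)
      then show ?thesis by simp
    qed
    have never: "card {e \<in> ?I. c e = s} = 0" if "s \<notin> c ` ?I" for s
    proof -
      have "{e \<in> ?I. c e = s} = {}" using that by blast
      then show ?thesis by (simp only: card.empty)
    qed
    have im: "c ` ?I \<subseteq> {0..<m}" using bij_betwE[OF c] sub by (fastforce simp: m_def)
    show "\<exists>R\<subseteq>{0..<m}. card R = card ?I mod m \<and>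
        (\<forall>s\<in>R. card {e \<in> ?I. c e = s} = card ?I div m + 1) \<and>
        (\<forall>s\<in>{0..<m} - R. card {e \<in> ?I. c e = s} = card ?I div m)"
      by (rule exI[of _ "c ` ?I"]) (use im lt once never card_image[OF inj] in simp)
  qed simp_all
  then show ?thesis
    unfolding homogeneously_colorable_def by (intro exI[of _ m]) (auto simp: m_def)
qed

end

theory Submission imports Defs begin

text \<open>
  The edges of a finite acyclic graph can be colored greedily. Such a graph, if it has an edge, has
  a vertex of degree 1, namely an end of a longest path. Remove its edge, split the remaining edges
  into two classes that are balanced at every vertex, and put the removed edge into the class that
  is not larger at its other end. Balanced classes are exactly the color classes of a
  2-homogeneous coloring.
\<close>

text \<open>The indexing is that of \<open>is_cycle\<close> without the wrap-around, so an initial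
  segment of a path together with one closing edge has the shape of a cycle. Edges are listed
  explicitly because parallel edges have the same ends.\<close>

definition is_path :: "'e set \<Rightarrow> ('e \<Rightarrow> 'v set) \<Rightarrow> 'v list \<Rightarrow> 'e list \<Rightarrow> bool" where
  "is_path E ends vs es \<longleftrightarrow>
     length vs = Suc (length es) \<and> distinct vs \<and> set es \<subseteq> E \<and>
     (\<forall>i<length es. ends (es ! i) = {vs ! i, vs ! Suc i})"

text \<open>In a list of distinct vertices, pairs of neighbors at different positions are different
  sets.\<close>

lemma is_path_distinct_edges:
  assumes "is_path E ends vs es"
  shows "distinct es"
proof (unfold distinct_conv_nth, intro allI impI)
  fix i j assume ij: "i < length es" "j < length es" "i \<noteq> j"
  show "es ! i \<noteq> es ! j"
  proof
    assume "es ! i = es ! j"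
    then have "{vs ! i, vs ! Suc i} = {vs ! j, vs ! Suc j}"
      using assms ij by (metis is_path_def)
    then show False
      using assms ij by (auto simp: is_path_def doubleton_eq_iff nth_eq_iff_index_eq)
  qed
qed

lemma is_path_Cons:
  assumes "is_path E ends vs es" "f \<in> E" "ends f = {w, hd vs}" "w \<notin> set vs"
  shows "is_path E ends (w # vs) (f # es)"
  using assms by (cases vs) (auto simp: is_path_def nth_Cons split: nat.splits)

text \<open>The chord \<open>f\<close> closes the initial segment ending at \<open>vs ! i\<close>.
  For \<open>i = 1\<close> it is parallel to the first edge, and \<open>f \<noteq> hd es\<close>
  makes the two a cycle of length 2.\<close>

lemma is_path_chord_is_cycle:
  assumes path: "is_path E ends vs es"
    and f: "f \<in> E" "f \<noteq> hd es" "ends f = {vs ! i, hd vs}"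
    and i: "0 < i" "i < length vs"
  shows "is_cycle E ends (take (Suc i) vs) (take i es @ [f])"
proof -
  have len: "i \<le> length es" and vs: "length vs = Suc (length es)"
    using path i by (auto simp: is_path_def)
  have hd: "hd vs = vs ! 0" "hd es = es ! 0"
    using len vs i by (cases vs; cases es; simp)+
  \<comment> \<open>Since the vertices are distinct, the first edge is the only edge of the path at
    \<open>hd vs\<close>, and \<open>f\<close> is a different edge at \<open>hd vs\<close>.\<close>
  have "f \<notin> set (take i es)"
  proof
    assume "f \<in> set (take i es)"
    then obtain j where j: "j < i" "f = es ! j"
      using len by (auto simp: in_set_conv_nth)
    with path len have "ends f = {vs ! j, vs ! Suc j}" by (simp add: is_path_def)
    moreover have "vs ! 0 \<in> ends f" using f(3) hd(1) by simp
    ultimately have "vs ! 0 = vs ! j \<or> vs ! 0 = vs ! Suc j" by simp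
    moreover have "distinct vs" using path by (simp add: is_path_def)
    moreover have "0 < length vs" "j < length vs" "Suc j < length vs" using j len vs by auto
    ultimately have "j = 0" by (metis nth_eq_iff_index_eq nat.distinct(1))
    with j f(2) hd(2) show False by simp
  qed
  then have "distinct (take i es @ [f])"
    using is_path_distinct_edges[OF path] by simp
  moreover have "ends ((take i es @ [f]) ! k) =
      {take (Suc i) vs ! k, take (Suc i) vs ! (Suc k mod Suc i)}" if "k < Suc i" for k
  proof (cases "k = i")
    \<comment> \<open>Here \<open>Suc k mod Suc i = 0\<close>: the chord leads back to the first
      vertex.\<close>
    case True
    then show ?thesis using f(3) hd len by (simp add: nth_append)
  next
    case False
    then show ?thesis using that path len by (simp add: is_path_def nth_append)
  qed
  moreover have "distinct (take (Suc i) vs)" "set (take i es @ [f]) \<subseteq> E"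
    using path f(1) by (auto simp: is_path_def dest: in_set_takeD)
  moreover have "length (take (Suc i) vs) = Suc i" "length (take i es @ [f]) = Suc i"
    using len vs by simp_all
  ultimately show ?thesis unfolding is_cycle_def by simp
qed

text \<open>Each vertex of a path with an edge is an end of one of its edges. A path without edges
  could be a single vertex outside \<open>V\<close>.\<close>

lemma (in graph) is_path_vertices:
  assumes "is_path E ends vs es" "es \<noteq> []"
  shows "set vs \<subseteq> V"
proof
  fix x assume "x \<in> set vs"
  then obtain i where i: "i < length vs" "x = vs ! i" by (auto simp: in_set_conv_nth)
  \<comment> \<open>The last vertex has no edge after it, so the edge before it is taken.\<close>
  define k where "k = (if i < length es then i else i - 1)"
  have "k < length es" "x \<in> {vs ! k, vs ! Suc k}"
    using i assms by (auto simp: k_def is_path_def less_Suc_eq)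
  then have "x \<in> ends (es ! k)" "es ! k \<in> E"
    using assms(1) by (auto simp: is_path_def)
  then show "x \<in> V" using ends_subset by blast
qed

text \<open>On a longest path with at least one edge, a further edge at the first vertex would
  either leave the path and extend it, or return to it and close a cycle.\<close>

lemma (in graph) acyclic_imp_leaf:
  assumes acyclic: "\<nexists>vs es. is_cycle E ends vs es" and "E \<noteq> {}"
  obtains v e where "incident_edges E ends v = {e}"
proof -
  let ?P = "\<lambda>(vs, es). es \<noteq> [] \<and> is_path E ends vs es"
  obtain e where e: "e \<in> E" using \<open>E \<noteq> {}\<close> by blast
  then obtain a b where "ends e = {a, b}" "a \<noteq> b"
    using card_ends[OF e] by (auto simp: card_2_iff)
  with e have "?P ([a, b], [e])" by (simp add: is_path_def)
  \<comment> \<open>This bound guarantees that a longest path exists.\<close>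
  moreover have "length (fst p) < Suc (card V)" if "?P p" for p
  proof -
    have "distinct (fst p)" "set (fst p) \<subseteq> V"
      using that is_path_vertices[of "fst p" "snd p"] by (auto simp: is_path_def)
    then show ?thesis
      using card_mono[OF finite_V] distinct_card by (metis less_Suc_eq_le)
  qed
  ultimately obtain p where "?P p"
      and "\<forall>q. ?P q \<longrightarrow> length (fst q) \<le> length (fst p)"
    using ex_has_greatest_nat[of ?P _ "length \<circ> fst" "Suc (card V)"] by fastforce
  then obtain vs es where path: "is_path E ends vs es" "es \<noteq> []"
      and longest: "\<And>vs' es'. es' \<noteq> [] \<Longrightarrow> is_path E ends vs' es' \<Longrightarrow> length vs' \<le> length vs"
    by (cases p) auto
  have hd: "hd vs = vs ! 0" "hd es = es ! 0"
    using path by (cases vs; cases es; simp add: is_path_def)+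
  have "incident_edges E ends (hd vs) = {hd es}"
  proof (intro equalityI subsetI)
    fix f assume "f \<in> incident_edges E ends (hd vs)"
    then have f: "f \<in> E" "hd vs \<in> ends f" by (auto simp: incident_edges_def)
    then obtain w where w: "ends f = {w, hd vs}" "w \<noteq> hd vs"
      using card_ends[OF f(1)] by (fastforce simp: card_2_iff doubleton_eq_iff)
    have "w \<in> set vs"
      using longest[of "f # es" "w # vs"] is_path_Cons[OF path(1) f(1) w(1)] by auto
    then obtain i where i: "i < length vs" "w = vs ! i" by (auto simp: in_set_conv_nth)
    \<comment> \<open>An edge other than \<open>hd es\<close> would now be a chord and close a
      cycle.\<close>
    with w hd have "0 < i" by (cases i) auto
    then show "f \<in> {hd es}"
      using is_path_chord_is_cycle[OF path(1) f(1), of i] acyclic w i by auto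
  next
    fix f assume "f \<in> {hd es}"
    then show "f \<in> incident_edges E ends (hd vs)"
      using path hd by (auto simp: incident_edges_def is_path_def)
  qed
  then show thesis by (rule that)
qed

lemma finite_incident_edges: "finite E \<Longrightarrow> finite (incident_edges E ends x)"
  by (simp add: incident_edges_def)

lemma incident_edges_insert:
  "incident_edges (insert e E) ends x =
     (if x \<in> ends e then insert e (incident_edges E ends x) else incident_edges E ends x)"
  by (auto simp: incident_edges_def)

lemma card_incident_edges_insert:
  assumes "finite E" "e \<notin> E"
  shows "card (incident_edges (insert e E) ends x) =
    card (incident_edges E ends x) + of_bool (x \<in> ends e)"
proof -
  have "e \<notin> incident_edges E ends x" using assms by (simp add: incident_edges_def)
  then show ?thesis
    using finite_incident_edges[OF assms(1), of ends x] by (simp add: incident_edges_insert)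
qed

text \<open>The induction is on the edge set with \<open>V\<close> fixed. Deleting the edge at a
  leaf isolates that leaf, so acyclicity survives the step but connectedness does not; hence the
  statement is about acyclic graphs instead of trees.\<close>

lemma acyclic_imp_balanced_split:
  assumes "graph V E ends" "\<nexists>vs es. is_cycle E ends vs es"
  shows "\<exists>A\<subseteq>E. \<forall>x.
    card (incident_edges A ends x) \<le> Suc (card (incident_edges (E - A) ends x)) \<and>
    card (incident_edges (E - A) ends x) \<le> Suc (card (incident_edges A ends x))"
  using graph.finite_E[OF assms(1)] assms
proof (induction E rule: finite_psubset_induct)
  case (psubset E)
  let ?d = "\<lambda>A x. card (incident_edges A ends x)"
  interpret graph V E ends by (fact psubset.prems(1))
  show ?case
  proof (cases "E = {}")
    case True
    then show ?thesis by (auto simp: incident_edges_def)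
  next
    case False
    then obtain v e where leaf: "incident_edges E ends v = {e}"
      using acyclic_imp_leaf psubset.prems(2) by blast
    then have e: "e \<in> E" "v \<in> ends e" by (auto simp: incident_edges_def)
    then obtain y where y: "ends e = {v, y}" "v \<noteq> y"
      using card_ends[OF e(1)] by (fastforce simp: card_2_iff doubleton_eq_iff)
    have "graph V (E - {e}) ends"
      using finite_V finite_E ends_subset card_ends by unfold_locales auto
    moreover have "\<nexists>vs es. is_cycle (E - {e}) ends vs es"
      using psubset.prems(2) by (auto simp: is_cycle_def)
    ultimately obtain A where A: "A \<subseteq> E - {e}"
        and bal: "\<And>x. ?d A x \<le> Suc (?d (E - {e} - A) x)" "\<And>x. ?d (E - {e} - A) x \<le> Suc (?d A x)"
      using psubset.IH[of "E - {e}"] e(1) by blast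
    define B where "B = E - {e} - A"
    have fin: "finite A" "finite B" and notin: "e \<notin> A" "e \<notin> B"
      using A finite_E by (auto simp: B_def intro: finite_subset)
    \<comment> \<open>As \<open>e\<close> is the only edge at \<open>v\<close>, the counts at
      \<open>v\<close> become 1 and 0 whichever class receives \<open>e\<close>.\<close>
    have zero: "?d A v = 0" "?d B v = 0"
      using leaf A unfolding B_def incident_edges_def by (auto simp: card_eq_0_iff)
    note insert_simps = card_incident_edges_insert[OF fin(1) notin(1)]
      card_incident_edges_insert[OF fin(2) notin(2)]
    have compl: "E - insert e A = B" "E - A = insert e B"
      using A e by (auto simp: B_def)
    show ?thesis
    \<comment> \<open>Only the counts at \<open>v\<close> and \<open>y\<close> change. At
      \<open>y\<close> the receiving class was not ahead, so afterwards it leads by at most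
      one.\<close>
    proof (cases "?d A y \<le> ?d B y")
      case True
      then have "?d (insert e A) x \<le> Suc (?d B x) \<and> ?d B x \<le> Suc (?d (insert e A) x)" for x
        using bal[of x, folded B_def] zero y by (auto simp: insert_simps)
      then show ?thesis
        using A e compl by (intro exI[of _ "insert e A"]) auto
    next
      case False
      then have "?d A x \<le> Suc (?d (insert e B) x) \<and> ?d (insert e B) x \<le> Suc (?d A x)" for x
        using bal[of x, folded B_def] zero y by (auto simp: insert_simps)
      then show ?thesis
        using A compl by (intro exI[of _ A]) auto
    qed
  qed
qed

lemma balanced_split_imp_homogeneously_colorable:
  assumes "finite E" "A \<subseteq> E"
    and bal: "\<And>x. card (incident_edges A ends x) \<le> Suc (card (incident_edges (E - A) ends x))"
      "\<And>x. card (incident_edges (E - A) ends x) \<le> Suc (card (incident_edges A ends x))"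
  shows "homogeneously_colorable V E ends 2"
proof -
  define c :: "'a \<Rightarrow> nat" where "c e = of_bool (e \<in> A)" for e
  have "homogeneous_coloring V E ends 2 {0, 1} c"
    unfolding homogeneous_coloring_def Let_def
  proof (intro conjI ballI)
    show "c \<in> E \<rightarrow> {0, 1}" by (auto simp: c_def)
  next
    fix x
    let ?I = "incident_edges E ends x"
    define a where "a = card (incident_edges A ends x)"
    define b where "b = card (incident_edges (E - A) ends x)"
    have occ: "card {e \<in> ?I. c e = 0} = b" "card {e \<in> ?I. c e = 1} = a"
      using \<open>A \<subseteq> E\<close> unfolding a_def b_def
      by (auto simp: c_def incident_edges_def intro!: arg_cong[of _ _ card])
    have "?I = incident_edges A ends x \<union> incident_edges (E - A) ends x"
      using \<open>A \<subseteq> E\<close> by (auto simp: incident_edges_def)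
    also have "card \<dots> = a + b"
      unfolding a_def b_def
      by (intro card_Un_disjoint finite_incident_edges)
        (use assms in \<open>auto simp: incident_edges_def intro: finite_subset\<close>)
    finally have card: "card ?I = a + b" .
    \<comment> \<open>\<open>R\<close> consists of the color in surplus: it is empty if
      \<open>a = b\<close>, and otherwise it contains the color of the larger class, 1 for
      \<open>A\<close> and 0 for its complement. The smaller count is the quotient
      \<open>q\<close>.\<close>
    consider "a = b" | "a = Suc b" | "b = Suc a"
      using bal[of x] by (fold a_def b_def) linarith
    then show "\<exists>R\<subseteq>{0, 1}. card R = card ?I mod 2 \<and>
        (\<forall>s\<in>R. card {e \<in> ?I. c e = s} = card ?I div 2 + 1) \<and>
        (\<forall>s\<in>{0, 1} - R. card {e \<in> ?I. c e = s} = card ?I div 2)"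
    proof cases
      case 1
      then show ?thesis using occ card by (intro exI[of _ "{}"]) auto
    next
      case 2
      then have "card ?I = Suc (2 * b)" using card by simp
      then show ?thesis using occ 2 by (intro exI[of _ "{1}"]) auto
    next
      case 3
      then have "card ?I = Suc (2 * a)" using card by simp
      then show ?thesis using occ 3 by (intro exI[of _ "{0}"]) auto
    qed
  qed simp_all
  then show ?thesis unfolding homogeneously_colorable_def by blast
qed

theorem theorem4p1:
  fixes V :: "'v set" and E :: "'e set" and ends :: "'e \<Rightarrow> 'v set"
  assumes "tree V E ends"
    and "card V \<ge> 3"
  shows "homogeneous_chromatic_index V E ends = 2"
proof -
  interpret tree V E ends by (fact assms(1))
  obtain A where "A \<subseteq> E"
      and "\<And>x. card (incident_edges A ends x) \<le> Suc (card (incident_edges (E - A) ends x))"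
      and "\<And>x. card (incident_edges (E - A) ends x) \<le> Suc (card (incident_edges A ends x))"
    using acyclic_imp_balanced_split[OF graph_axioms acyclic] by blast
  then have "homogeneously_colorable V E ends 2"
    by (rule balanced_split_imp_homogeneously_colorable[OF finite_E])
  \<comment> \<open>The \<open>LEAST\<close> ranges over \<open>m\<close> with
    \<open>2 \<le> m\<close> only, so a coloring for 2 already attains the minimum.\<close>
  then show ?thesis
    unfolding homogeneous_chromatic_index_def by (intro Least_equality) auto
qed

end
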